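(* Let $R$ be a commutative ring, let $\mathcal M$, $\mathcal P$, $\mathcal P'$ satisfy conditions (1)–(5) of the context, and let $\mathrm{cl}$ be a cofunctorial closure operation defined on $\mathcal P$. Then the cohereditary version $\mathrm{cl}_{\mathrm r}$ of $\mathrm{cl}$ is a residual, cofunctorial closure operation on $\mathcal P'$, given as follows: for $(L,M)\in\mathcal P'$, $$L^{\mathrm{cl}_{\mathrm r}}_M:=\pi\big((\pi^{-1}(L))^{\mathrm{cl}}_P\big),$$ where $\pi:P\twoheadrightarrow M$ is any surjection in $\mathcal M$ with $P$ projective and $(\pi^{-1}(L),P)\in\mathcal P$. In particular, if $\mathrm{cl}$ is itself residual (and defined and cofunctorial on $\mathcal P'$), then $\mathrm{cl}=\mathrm{cl}_{\mathrm r}$.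
   Context: Setting: (1) $\mathcal M$ is an abelian category of $R$-modules (and $R$-linear maps) that has enough projectives. Submodule inclusions, quotient maps, kernels, images and cokernels in $\mathcal M$ are the usual module-theoretic ones; "projective" means projective in $\mathcal M$; all homomorphisms are morphisms of $\mathcal M$. (2) $\mathcal P$ is a set of pairs $(N,P)$ with $N\subseteq P$, $N,P\in\mathcal M$, and $P$ projective. (3) $\mathcal P'$ is a set of pairs $(L,M)$ of modules in $\mathcal M$ with $L\subseteq M$ such that $\mathcal P\subseteq\mathcal P'$ and for every $(L,M)\in\mathcal P'$ there are a projective module $P\in\mathcal M$ and a surjection $\pi:P\to M$ in $\mathcal M$ with $(\pi^{-1}(L),P)\in\mathcal P$. (4) If $(L,M),(N,M)\in\mathcal P'$ with $L\subseteq N$, then there exists a surjection $\pi:P\twoheadrightarrow M$ in $\mathcal M$, $P$ projective, such that $(\pi^{-1}(L),P),(\pi^{-1}(N),P)\in\mathcal P$. (5) Given $L,M,P,\pi$ as in (3), if $\phi:M\to N$ is a surjection in $\mathcal M$, $q:Q\to N$ is a surjection in $\mathcal M$ from a projective module $Q$ with $(q^{-1}(\phi(L)),Q)\in\mathcal P$, and $\tilde\phi:P\to Q$ is any map in $\mathcal M$ with $\phi\circ\pi=q\circ\tilde\phi$, then $(\tilde\phi(\pi^{-1}(L)),Q)\in\mathcal P$. Both $\mathcal P$ and $\mathcal P'$ are closed under isomorphism: if $(L,M)$ is in the class and $\phi:M\to M'$ is an isomorphism in $\mathcal M$, then $(\phi(L),M')$ is in the class. A pair operation $p$ on such a class sends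 each pair $(L,M)$ to a submodule $p(L,M)$ of $M$ with $\phi(p(L,M))=p(\phi(L),M')$ for every isomorphism $\phi:M\to M'$ in $\mathcal M$. It is: extensive if $L\subseteq p(L,M)$; order-preserving on submodules if $p(L,M)\subseteq p(N,M)$ whenever $L\subseteq N\subseteq M$ and both pairs are in the class; idempotent if $p(p(L,M),M)=p(L,M)$ whenever $(L,M)$ and $(p(L,M),M)$ are in the class; a closure operation if it is extensive, order-preserving on submodules and idempotent; cofunctorial if $p(g^{-1}(L),M)\subseteq g^{-1}(p(L,M'))$ whenever $g:M\to M'$ is in $\mathcal M$ and both pairs are in the class; residual if $p(N,M)=\pi^{-1}(p(N/L,M/L))$ whenever $L\subseteq N\subseteq M$ and $(N,M),(N/L,M/L)$ are in the class, $\pi:M\twoheadrightarrow M/L$ the natural map. For a closure operation write $L^{\mathrm{cl}}_M:=\mathrm{cl}(L,M)$. The formula for $\mathrm{cl}_{\mathrm r}$ does not depend on the choice of $\pi$ (this is part of the construction of the cohereditary version of a cofunctorial pair operation). *)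

theory Defs
  imports "HOL-Algebra.Module" "HOL-Algebra.AbelCoset"
begin

section \<open>Linear maps, preimages and quotient modules\<close>

definition linear_maps ::
  "('r, 's) ring_scheme \<Rightarrow> ('r, 'a) module \<Rightarrow> ('r, 'b) module \<Rightarrow> ('a \<Rightarrow> 'b) set" where
  "linear_maps R M N = {f \<in> hom (add_monoid M) (add_monoid N).
     \<forall>a\<in>carrier R. \<forall>x\<in>carrier M. f (a \<odot>\<^bsub>M\<^esub> x) = a \<odot>\<^bsub>N\<^esub> f x}"

definition preimage :: "('r, 'a) module \<Rightarrow> ('a \<Rightarrow> 'b) \<Rightarrow> 'b set \<Rightarrow> 'a set" where
  "preimage M f L = {x \<in> carrier M. f x \<in> L}"

text \<open>
  The module of cosets of \<open>L\<close> in \<open>M\<close>. The product with a scalar \<open>a\<close> is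
  \<open>a(x + L) = ax + L\<close>, written so that no representative has to be chosen. The fields
  \<open>mult\<close> and \<open>one\<close>, which records of type \<open>module\<close> inherit from rings,
  play no role for modules.
\<close>

definition quotient_module :: "('r, 'a) module \<Rightarrow> 'a set \<Rightarrow> ('r, 'a set) module" where
  "quotient_module M L =
     \<lparr>carrier = a_rcosets\<^bsub>M\<^esub> L, mult = (\<lambda>X Y. undefined), one = undefined,
      zero = L, add = (\<lambda>X Y. X <+>\<^bsub>M\<^esub> Y),
      smult = (\<lambda>a X. \<Union>x\<in>X. L +>\<^bsub>M\<^esub> (a \<odot>\<^bsub>M\<^esub> x))\<rparr>"


section \<open>Categories of modules\<close>

text \<open>
  All objects have their elements in one type \<open>'m\<close>. The arrows are functions that matter only
  on the carrier of their domain. They need not be all the linear maps, so the subcategory of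
  modules is not required to be full.
\<close>

record ('r, 'm) module_cat =
  Obj :: "('r, 'm) module set"
  Hom :: "('r, 'm) module \<Rightarrow> ('r, 'm) module \<Rightarrow> ('m \<Rightarrow> 'm) set"

definition is_arrow ::
  "('r, 'm) module_cat \<Rightarrow> ('r, 'm) module \<Rightarrow> ('r, 'm) module \<Rightarrow> ('m \<Rightarrow> 'm) \<Rightarrow> bool" where
  "is_arrow C A B f \<longleftrightarrow> A \<in> Obj C \<and> B \<in> Obj C \<and> f \<in> Hom C A B"

definition agree :: "('r, 'm) module \<Rightarrow> ('m \<Rightarrow> 'm) \<Rightarrow> ('m \<Rightarrow> 'm) \<Rightarrow> bool" where
  "agree A f g \<longleftrightarrow> (\<forall>x\<in>carrier A. f x = g x)"

definition is_surjection ::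
  "('r, 'm) module_cat \<Rightarrow> ('r, 'm) module \<Rightarrow> ('r, 'm) module \<Rightarrow> ('m \<Rightarrow> 'm) \<Rightarrow> bool" where
  "is_surjection C A B f \<longleftrightarrow> is_arrow C A B f \<and> f ` carrier A = carrier B"

definition is_isomorphism ::
  "('r, 'm) module_cat \<Rightarrow> ('r, 'm) module \<Rightarrow> ('r, 'm) module \<Rightarrow> ('m \<Rightarrow> 'm) \<Rightarrow> bool" where
  "is_isomorphism C A B f \<longleftrightarrow> is_arrow C A B f \<and>
     (\<exists>g. is_arrow C B A g \<and> agree A (g \<circ> f) id \<and> agree B (f \<circ> g) id)"

definition is_mono ::
  "('r, 'm) module_cat \<Rightarrow> ('r, 'm) module \<Rightarrow> ('r, 'm) module \<Rightarrow> ('m \<Rightarrow> 'm) \<Rightarrow> bool" where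
  "is_mono C A B f \<longleftrightarrow> is_arrow C A B f \<and>
     (\<forall>T g h. is_arrow C T A g \<and> is_arrow C T A h \<and> agree T (f \<circ> g) (f \<circ> h) \<longrightarrow> agree T g h)"

definition is_epi ::
  "('r, 'm) module_cat \<Rightarrow> ('r, 'm) module \<Rightarrow> ('r, 'm) module \<Rightarrow> ('m \<Rightarrow> 'm) \<Rightarrow> bool" where
  "is_epi C A B f \<longleftrightarrow> is_arrow C A B f \<and>
     (\<forall>T g h. is_arrow C B T g \<and> is_arrow C B T h \<and> agree A (g \<circ> f) (h \<circ> f) \<longrightarrow> agree B g h)"

definition zero_map :: "('r, 'm) module \<Rightarrow> 'm \<Rightarrow> 'm" where
  "zero_map B = (\<lambda>_. \<zero>\<^bsub>B\<^esub>)"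

text \<open>Kernels and cokernels in \<open>C\<close>, by their universal properties.\<close>

definition is_kernel ::
  "('r, 'm) module_cat \<Rightarrow> ('r, 'm) module \<Rightarrow> ('r, 'm) module \<Rightarrow> ('m \<Rightarrow> 'm) \<Rightarrow>
     ('r, 'm) module \<Rightarrow> ('m \<Rightarrow> 'm) \<Rightarrow> bool" where
  "is_kernel C A B f K k \<longleftrightarrow>
     is_arrow C A B f \<and> is_arrow C K A k \<and> agree K (f \<circ> k) (zero_map B) \<and>
     (\<forall>T g. is_arrow C T A g \<and> agree T (f \<circ> g) (zero_map B) \<longrightarrow>
        (\<exists>h. is_arrow C T K h \<and> agree T (k \<circ> h) g \<and>
           (\<forall>h'. is_arrow C T K h' \<and> agree T (k \<circ> h') g \<longrightarrow> agree T h' h)))"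

definition is_cokernel ::
  "('r, 'm) module_cat \<Rightarrow> ('r, 'm) module \<Rightarrow> ('r, 'm) module \<Rightarrow> ('m \<Rightarrow> 'm) \<Rightarrow>
     ('r, 'm) module \<Rightarrow> ('m \<Rightarrow> 'm) \<Rightarrow> bool" where
  "is_cokernel C A B f Q q \<longleftrightarrow>
     is_arrow C A B f \<and> is_arrow C B Q q \<and> agree A (q \<circ> f) (zero_map Q) \<and>
     (\<forall>T g. is_arrow C B T g \<and> agree A (g \<circ> f) (zero_map T) \<longrightarrow>
        (\<exists>h. is_arrow C Q T h \<and> agree B (h \<circ> q) g \<and>
           (\<forall>h'. is_arrow C Q T h' \<and> agree B (h' \<circ> q) g \<longrightarrow> agree Q h' h)))"

definition is_biproduct ::
  "('r, 'm) module_cat \<Rightarrow> ('r, 'm) module \<Rightarrow> ('r, 'm) module \<Rightarrow> ('r, 'm) module \<Rightarrow> bool" where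
  "is_biproduct C A B S \<longleftrightarrow>
     (\<exists>i j p q. is_arrow C A S i \<and> is_arrow C B S j \<and> is_arrow C S A p \<and> is_arrow C S B q \<and>
        agree A (p \<circ> i) id \<and> agree B (q \<circ> j) id \<and>
        agree A (q \<circ> i) (zero_map B) \<and> agree B (p \<circ> j) (zero_map A) \<and>
        agree S (\<lambda>x. i (p x) \<oplus>\<^bsub>S\<^esub> j (q x)) id)"

definition is_submodule_in ::
  "('r, 's) ring_scheme \<Rightarrow> ('r, 'm) module_cat \<Rightarrow> 'm set \<Rightarrow> ('r, 'm) module \<Rightarrow> bool" where
  "is_submodule_in R C L M \<longleftrightarrow>
     submodule L R M \<and> is_arrow C (M\<lparr>carrier := L\<rparr>) M (\<lambda>x. x)"

text \<open>
  The elements of the coset module of \<open>M\<close> modulo \<open>L\<close> are of type \<open>'m set\<close>, so it is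
  not itself an object. It is represented by an object \<open>Q\<close> together with a linear isomorphism
  \<open>\<theta>\<close> from the coset module onto \<open>Q\<close>; then \<open>q\<close> is the natural map, and
  \<open>N/L\<close> corresponds to \<open>q ` N\<close>.
\<close>

definition is_quotient_in ::
  "('r, 's) ring_scheme \<Rightarrow> ('r, 'm) module_cat \<Rightarrow> ('r, 'm) module \<Rightarrow> 'm set \<Rightarrow>
     ('r, 'm) module \<Rightarrow> ('m \<Rightarrow> 'm) \<Rightarrow> bool" where
  "is_quotient_in R C M L Q q \<longleftrightarrow>
     submodule L R M \<and> is_arrow C M Q q \<and>
     (\<exists>\<theta>. \<theta> \<in> linear_maps R (quotient_module M L) Q \<and>
          bij_betw \<theta> (carrier (quotient_module M L)) (carrier Q) \<and>
          (\<forall>x\<in>carrier M. q x = \<theta> (L +>\<^bsub>M\<^esub> x)))"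

locale module_category =
  fixes R :: "('r, 's) ring_scheme" and C :: "('r, 'm) module_cat"
  assumes cring_R: "cring R"
    and obj_module: "A \<in> Obj C \<Longrightarrow> module R A"
    and arrow_linear: "is_arrow C A B f \<Longrightarrow> f \<in> linear_maps R A B"
    and arrow_cong: "is_arrow C A B f \<Longrightarrow> agree A f g \<Longrightarrow> is_arrow C A B g"
    and arrow_id: "A \<in> Obj C \<Longrightarrow> is_arrow C A A id"
    and arrow_comp: "is_arrow C A B f \<Longrightarrow> is_arrow C B D g \<Longrightarrow> is_arrow C A D (g \<circ> f)"

text \<open>
  Abelian categories of modules whose additive structure, kernels and cokernels are the
  module-theoretic ones. The image of an arrow, being the kernel of its cokernel, is then the
  usual submodule of the codomain.
\<close>

locale abelian_module_category = module_category +
  assumes arrow_zero: "A \<in> Obj C \<Longrightarrow> B \<in> Obj C \<Longrightarrow> is_arrow C A B (zero_map B)"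
    and arrow_add: "is_arrow C A B f \<Longrightarrow> is_arrow C A B g \<Longrightarrow>
          is_arrow C A B (\<lambda>x. f x \<oplus>\<^bsub>B\<^esub> g x)"
    and arrow_minus: "is_arrow C A B f \<Longrightarrow> is_arrow C A B (\<lambda>x. \<ominus>\<^bsub>B\<^esub> f x)"
    and zero_object: "\<exists>Z\<in>Obj C. carrier Z = {\<zero>\<^bsub>Z\<^esub>}"
    and biproducts: "A \<in> Obj C \<Longrightarrow> B \<in> Obj C \<Longrightarrow> \<exists>S. is_biproduct C A B S"
    and kernels: "is_arrow C A B f \<Longrightarrow>
          is_kernel C A B f (A\<lparr>carrier := a_kernel A B f\<rparr>) (\<lambda>x. x)"
    and cokernels: "is_arrow C A B f \<Longrightarrow>
          \<exists>Q q. is_cokernel C A B f Q q \<and> is_quotient_in R C B (f ` carrier A) Q q"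
    and mono_normal: "is_mono C A B f \<Longrightarrow> \<exists>D g. is_kernel C B D g A f"
    and epi_normal: "is_epi C A B f \<Longrightarrow> \<exists>D g. is_cokernel C D A g B f"

definition is_projective :: "('r, 'm) module_cat \<Rightarrow> ('r, 'm) module \<Rightarrow> bool" where
  "is_projective C P \<longleftrightarrow> P \<in> Obj C \<and>
     (\<forall>A B e f. is_epi C A B e \<and> is_arrow C P B f \<longrightarrow>
        (\<exists>g. is_arrow C P A g \<and> agree P (e \<circ> g) f))"

definition enough_projectives :: "('r, 'm) module_cat \<Rightarrow> bool" where
  "enough_projectives C \<longleftrightarrow> (\<forall>M\<in>Obj C. \<exists>P e. is_projective C P \<and> is_epi C P M e)"


section \<open>Pair operations\<close>

type_synonym ('r, 'm) pairs = "('m set \<times> ('r, 'm) module) set"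
type_synonym ('r, 'm) pair_op = "'m set \<Rightarrow> ('r, 'm) module \<Rightarrow> 'm set"

definition iso_closed :: "('r, 'm) module_cat \<Rightarrow> ('r, 'm) pairs \<Rightarrow> bool" where
  "iso_closed C \<P> \<longleftrightarrow>
     (\<forall>L M M' \<phi>. (L, M) \<in> \<P> \<and> is_isomorphism C M M' \<phi> \<longrightarrow> (\<phi> ` L, M') \<in> \<P>)"

text \<open>
  Pair operations are total functions, of which only the values on the class \<open>\<P>\<close> matter.
\<close>

definition pair_operation ::
  "('r, 's) ring_scheme \<Rightarrow> ('r, 'm) module_cat \<Rightarrow> ('r, 'm) pairs \<Rightarrow> ('r, 'm) pair_op \<Rightarrow> bool" where
  "pair_operation R C \<P> p \<longleftrightarrow>
     (\<forall>(L, M)\<in>\<P>. submodule (p L M) R M \<and>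
        (\<forall>M' \<phi>. is_isomorphism C M M' \<phi> \<longrightarrow> \<phi> ` p L M = p (\<phi> ` L) M'))"

definition extensive :: "('r, 'm) pairs \<Rightarrow> ('r, 'm) pair_op \<Rightarrow> bool" where
  "extensive \<P> p \<longleftrightarrow> (\<forall>(L, M)\<in>\<P>. L \<subseteq> p L M)"

definition order_preserving :: "('r, 'm) pairs \<Rightarrow> ('r, 'm) pair_op \<Rightarrow> bool" where
  "order_preserving \<P> p \<longleftrightarrow>
     (\<forall>L N M. (L, M) \<in> \<P> \<and> (N, M) \<in> \<P> \<and> L \<subseteq> N \<longrightarrow> p L M \<subseteq> p N M)"

definition idempotent :: "('r, 'm) pairs \<Rightarrow> ('r, 'm) pair_op \<Rightarrow> bool" where
  "idempotent \<P> p \<longleftrightarrow>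
     (\<forall>L M. (L, M) \<in> \<P> \<and> (p L M, M) \<in> \<P> \<longrightarrow> p (p L M) M = p L M)"

definition closure_operation ::
  "('r, 's) ring_scheme \<Rightarrow> ('r, 'm) module_cat \<Rightarrow> ('r, 'm) pairs \<Rightarrow> ('r, 'm) pair_op \<Rightarrow> bool" where
  "closure_operation R C \<P> p \<longleftrightarrow>
     pair_operation R C \<P> p \<and> extensive \<P> p \<and> order_preserving \<P> p \<and> idempotent \<P> p"

definition cofunctorial :: "('r, 'm) module_cat \<Rightarrow> ('r, 'm) pairs \<Rightarrow> ('r, 'm) pair_op \<Rightarrow> bool" where
  "cofunctorial C \<P> p \<longleftrightarrow>
     (\<forall>L M M' g. is_arrow C M M' g \<and> (L, M') \<in> \<P> \<and> (preimage M g L, M) \<in> \<P> \<longrightarrow>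
        p (preimage M g L) M \<subseteq> preimage M g (p L M'))"

definition residual ::
  "('r, 's) ring_scheme \<Rightarrow> ('r, 'm) module_cat \<Rightarrow> ('r, 'm) pairs \<Rightarrow> ('r, 'm) pair_op \<Rightarrow> bool" where
  "residual R C \<P> p \<longleftrightarrow>
     (\<forall>L N M Q q. L \<subseteq> N \<and> (N, M) \<in> \<P> \<and> is_quotient_in R C M L Q q \<and> (q ` N, Q) \<in> \<P> \<longrightarrow>
        p N M = preimage M q (p (q ` N) Q))"


section \<open>The cohereditary version\<close>

definition is_presentation ::
  "('r, 'm) module_cat \<Rightarrow> ('r, 'm) pairs \<Rightarrow> 'm set \<Rightarrow> ('r, 'm) module \<Rightarrow>
     ('r, 'm) module \<Rightarrow> ('m \<Rightarrow> 'm) \<Rightarrow> bool" where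
  "is_presentation C \<P> L M P \<pi> \<longleftrightarrow>
     is_projective C P \<and> is_surjection C P M \<pi> \<and> (preimage P \<pi> L, P) \<in> \<P>"

definition cohereditary_version ::
  "('r, 'm) module_cat \<Rightarrow> ('r, 'm) pairs \<Rightarrow> ('r, 'm) pair_op \<Rightarrow> ('r, 'm) pair_op" where
  "cohereditary_version C \<P> p L M =
     (let (P, \<pi>) = (SOME (P, \<pi>). is_presentation C \<P> L M P \<pi>)
      in \<pi> ` p (preimage P \<pi> L) P)"

locale cohereditary_setting = abelian_module_category R C
  for R :: "('r, 's) ring_scheme" and C :: "('r, 'm) module_cat" +
  fixes \<P> :: "('r, 'm) pairs" and \<P>' :: "('r, 'm) pairs"
  assumes enough_projectives: "enough_projectives C"
    and pairs_projective: "(N, P) \<in> \<P> \<Longrightarrow> is_submodule_in R C N P \<and> is_projective C P"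
    and pairs'_submodule: "(L, M) \<in> \<P>' \<Longrightarrow> is_submodule_in R C L M"
    and pairs_subset: "\<P> \<subseteq> \<P>'"
    and pairs_iso_closed: "iso_closed C \<P>"
    and pairs'_iso_closed: "iso_closed C \<P>'"
    and presentation_exists: "(L, M) \<in> \<P>' \<Longrightarrow> \<exists>P \<pi>. is_presentation C \<P> L M P \<pi>"
    and common_presentation: "(L, M) \<in> \<P>' \<Longrightarrow> (N, M) \<in> \<P>' \<Longrightarrow> L \<subseteq> N \<Longrightarrow>
          \<exists>P \<pi>. is_presentation C \<P> L M P \<pi> \<and> is_presentation C \<P> N M P \<pi>"
    and lift_image: "(L, M) \<in> \<P>' \<Longrightarrow> is_presentation C \<P> L M P \<pi> \<Longrightarrow>
          is_surjection C M M' \<phi> \<Longrightarrow> is_presentation C \<P> (\<phi> ` L) M' Q q \<Longrightarrow>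
          is_arrow C P Q \<psi> \<Longrightarrow> agree P (\<phi> \<circ> \<pi>) (q \<circ> \<psi>) \<Longrightarrow>
          (\<psi> ` preimage P \<pi> L, Q) \<in> \<P>"

end

theory Submission
  imports Defs
begin

text \<open>
  Let \<open>\<pi> : P \<rightarrow> M\<close> and \<open>q : Q \<rightarrow> M'\<close> be the presentations of \<open>(g\<^sup>-\<^sup>1(L), M)\<close> and
  \<open>(L, M')\<close>. Lifting \<open>g \<circ> \<pi>\<close> along \<open>q\<close> to \<open>\<psi> : P \<rightarrow> Q\<close> and applying cofunctoriality of
  \<open>cl\<close> to \<open>\<psi>\<close> compares the two images of closures. This gives cofunctoriality, and for
  \<open>g = id\<close>, in both directions, independence of the presentation. The rest holds because
  \<open>(\<pi>\<^sup>-\<^sup>1(L))\<^sup>c\<^sup>l\<close> contains the kernel of \<open>\<pi>\<close> and is therefore recovered from its image in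
  \<open>M\<close>, and because a presentation of \<open>(N, M)\<close> followed by a surjection with kernel inside
  \<open>N\<close> presents the image pair.
\<close>

section \<open>Linear maps, submodules, and images versus preimages\<close>

lemma submodule_zero: "submodule H R M \<Longrightarrow> \<zero>\<^bsub>M\<^esub> \<in> H"
  using subgroup.one_closed[OF submodule.axioms(1)] by fastforce

lemma linear_map_closed:
  "f \<in> linear_maps R M N \<Longrightarrow> x \<in> carrier M \<Longrightarrow> f x \<in> carrier N"
  by (auto simp: linear_maps_def hom_def)

lemma linear_map_add:
  "f \<in> linear_maps R M N \<Longrightarrow> x \<in> carrier M \<Longrightarrow> y \<in> carrier M \<Longrightarrow>
    f (x \<oplus>\<^bsub>M\<^esub> y) = f x \<oplus>\<^bsub>N\<^esub> f y"
  by (auto simp: linear_maps_def hom_def)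

lemma linear_map_smult:
  "f \<in> linear_maps R M N \<Longrightarrow> a \<in> carrier R \<Longrightarrow> x \<in> carrier M \<Longrightarrow>
    f (a \<odot>\<^bsub>M\<^esub> x) = a \<odot>\<^bsub>N\<^esub> f x"
  by (auto simp: linear_maps_def)

lemma linear_map_group_hom:
  assumes "module R M" "module R N" "f \<in> linear_maps R M N"
  shows "group_hom (add_monoid M) (add_monoid N) f"
proof -
  interpret M: module R M by fact
  interpret N: module R N by fact
  show ?thesis
    using assms(3) M.a_group N.a_group
    by (auto simp: group_hom_def group_hom_axioms_def linear_maps_def)
qed

lemma linear_map_zero:
  assumes "module R M" "module R N" "f \<in> linear_maps R M N"
  shows "f \<zero>\<^bsub>M\<^esub> = \<zero>\<^bsub>N\<^esub>"
  using group_hom.hom_one[OF linear_map_group_hom[OF assms]] by simp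

lemma linear_map_neg:
  assumes "module R M" "module R N" "f \<in> linear_maps R M N" "x \<in> carrier M"
  shows "f (\<ominus>\<^bsub>M\<^esub> x) = \<ominus>\<^bsub>N\<^esub> f x"
  using group_hom.hom_inv[OF linear_map_group_hom[OF assms(1-3)]] assms(4)
  by (simp add: a_inv_def)

lemma linear_map_eq_kernel:
  assumes "module R M" "module R N" "f \<in> linear_maps R M N"
    and "x \<in> carrier M" "y \<in> carrier M" "f x = f y"
  shows "x \<ominus>\<^bsub>M\<^esub> y \<in> a_kernel M N f"
proof -
  interpret M: module R M by fact
  interpret N: module R N by fact
  show ?thesis
    using assms linear_map_closed[OF assms(3)]
    by (simp add: a_kernel_def' M.minus_eq linear_map_add[OF assms(3)] linear_map_neg N.r_neg)
qed

lemma a_kernel_submodule: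
  assumes "module R M" "module R N" "f \<in> linear_maps R M N"
  shows "submodule (a_kernel M N f) R M"
proof -
  interpret M: module R M by fact
  interpret N: module R N by fact
  show ?thesis
  proof (rule module.submoduleI[OF assms(1)])
    show "\<zero>\<^bsub>M\<^esub> \<in> a_kernel M N f"
      by (simp add: a_kernel_def' linear_map_zero[OF assms])
  next
    fix a assume "a \<in> a_kernel M N f"
    then show "\<ominus>\<^bsub>M\<^esub> a \<in> a_kernel M N f"
      by (simp add: a_kernel_def' linear_map_neg[OF assms])
  qed (auto simp: a_kernel_def' linear_map_add[OF assms(3)] linear_map_smult[OF assms(3)])
qed

lemma linear_image_submodule:
  assumes "module R M" "module R N" "f \<in> linear_maps R M N" "submodule H R M"
  shows "submodule (f ` H) R N"
proof (rule module.submoduleI[OF assms(2)])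
  note H = module.submoduleE[OF assms(1,4)]
  show "f ` H \<subseteq> carrier N"
    using H(1) linear_map_closed[OF assms(3)] by blast
  show "\<zero>\<^bsub>N\<^esub> \<in> f ` H"
    using submodule_zero[OF assms(4)] linear_map_zero[OF assms(1-3)] by force
  show "\<ominus>\<^bsub>N\<^esub> a \<in> f ` H" if a: "a \<in> f ` H" for a
  proof -
    obtain h where "h \<in> H" "a = f h"
      using a by blast
    then show ?thesis
      using H(1,3) linear_map_neg[OF assms(1-3), of h, symmetric] by auto
  qed
  show "a \<oplus>\<^bsub>N\<^esub> b \<in> f ` H" if a: "a \<in> f ` H" "b \<in> f ` H" for a b
  proof -
    obtain h k where "h \<in> H" "a = f h" "k \<in> H" "b = f k"
      using a by blast
    then show ?thesis
      using H(1,5) linear_map_add[OF assms(3), of h k, symmetric] by auto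
  qed
  show "a \<odot>\<^bsub>N\<^esub> x \<in> f ` H" if a: "a \<in> carrier R" "x \<in> f ` H" for a x
  proof -
    obtain h where "h \<in> H" "x = f h"
      using a by blast
    then show ?thesis
      using a(1) H(1,4) linear_map_smult[OF assms(3), of a h, symmetric] by auto
  qed
qed

text \<open>If \<open>f x = f h\<close> with \<open>h \<in> H\<close>, then \<open>x\<close> and
  \<open>h\<close> differ by an element of the kernel, hence of \<open>H\<close>. This is how
  closures are recovered from their images under a presentation or a quotient map.\<close>

lemma preimage_image:
  assumes "module R M" "module R N" "f \<in> linear_maps R M N"
    and H: "submodule H R M" "a_kernel M N f \<subseteq> H"
  shows "preimage M f (f ` H) = H"
proof
  interpret M: module R M by fact
  note HE = M.submoduleE[OF H(1)]
  show "H \<subseteq> preimage M f (f ` H)"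
    using HE(1) by (auto simp: preimage_def)
  show "preimage M f (f ` H) \<subseteq> H"
  proof
    fix x assume "x \<in> preimage M f (f ` H)"
    then obtain h where x: "x \<in> carrier M" and h: "h \<in> H" and eq: "f x = f h"
      by (auto simp: preimage_def)
    have hM: "h \<in> carrier M"
      using h HE(1) by blast
    have "x \<ominus>\<^bsub>M\<^esub> h \<in> H"
      using linear_map_eq_kernel[OF assms(1-3) x hM eq] H(2) by blast
    then have "(x \<ominus>\<^bsub>M\<^esub> h) \<oplus>\<^bsub>M\<^esub> h \<in> H"
      using h HE(5) by blast
    then show "x \<in> H"
      using x hM by (simp add: M.minus_eq M.a_assoc M.l_neg)
  qed
qed

lemma image_preimage:
  "f ` carrier M = carrier N \<Longrightarrow> L \<subseteq> carrier N \<Longrightarrow> f ` preimage M f L = L"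
  by (auto simp: preimage_def)

lemma a_kernel_subset_preimage:
  "\<zero>\<^bsub>N\<^esub> \<in> L \<Longrightarrow> a_kernel M N f \<subseteq> preimage M f L"
  by (auto simp: a_kernel_def' preimage_def)

text \<open>Moving by an element of the kernel does not change the value of \<open>f\<close>, and a
  coset is nonempty. This makes the map induced on the quotient by the kernel well defined.\<close>

lemma a_coset_image:
  assumes "module R M" "module R N" "f \<in> linear_maps R M N" "x \<in> carrier M"
  shows "f ` (a_kernel M N f +>\<^bsub>M\<^esub> x) = {f x}"
proof -
  interpret M: module R M by fact
  interpret N: module R N by fact
  have "f (k \<oplus>\<^bsub>M\<^esub> x) = f x" if "k \<in> a_kernel M N f" for k
    using that assms(4) linear_map_closed[OF assms(3)]
    by (simp add: a_kernel_def' linear_map_add[OF assms(3)])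
  then have "f ` (a_kernel M N f +>\<^bsub>M\<^esub> x) = (\<lambda>k. f x) ` a_kernel M N f"
    by (auto simp: a_r_coset_def' image_UN)
  also have "\<dots> = {f x}"
    using M.submoduleE(2)[OF a_kernel_submodule[OF assms(1-3)]] by auto
  finally show ?thesis .
qed

section \<open>Surjections, projective lifts and quotients in the category\<close>

lemma (in module_category) surjection_linear:
  assumes "is_surjection C A B f"
  shows "module R A" "module R B" "f \<in> linear_maps R A B" "f ` carrier A = carrier B"
  using assms obj_module arrow_linear by (auto simp: is_surjection_def is_arrow_def)

lemma (in module_category) surjection_comp:
  assumes "is_surjection C A B f" "is_surjection C B D g"
  shows "is_surjection C A D (g \<circ> f)"
  using assms arrow_comp unfolding is_surjection_def by (metis image_comp)

lemma (in module_category) isomorphism_bij: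
  assumes "is_isomorphism C A B f"
  shows "is_surjection C A B f" "inj_on f (carrier A)"
proof -
  obtain g where f: "is_arrow C A B f" and g: "is_arrow C B A g"
    and gf: "agree A (g \<circ> f) id" and fg: "agree B (f \<circ> g) id"
    using assms by (auto simp: is_isomorphism_def)
  show "inj_on f (carrier A)"
    using gf by (auto simp: agree_def intro!: inj_on_inverseI[where g = g])
  have "f ` carrier A = carrier B"
  proof
    show "f ` carrier A \<subseteq> carrier B"
      using linear_map_closed[OF arrow_linear[OF f]] by blast
    show "carrier B \<subseteq> f ` carrier A"
      using linear_map_closed[OF arrow_linear[OF g]] fg by (force simp: agree_def)
  qed
  then show "is_surjection C A B f"
    using f by (simp add: is_surjection_def)
qed

text \<open>Bridges two notions: projectivity is stated with epimorphisms, presentations with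
  surjections.\<close>

lemma (in module_category) surjection_is_epi:
  assumes "is_surjection C A B f"
  shows "is_epi C A B f"
  using assms by (auto simp: is_surjection_def is_epi_def agree_def) (metis image_iff)

lemma (in module_category) projective_lift:
  assumes "is_projective C P" "is_surjection C A B e" "is_arrow C P B f"
  obtains g where "is_arrow C P A g" "agree P (e \<circ> g) f"
  using assms surjection_is_epi by (meson is_projective_def)

text \<open>Extracts from the coset description the two facts needed for residuality: surjectivity
  comes from that of \<theta>, the bound on the kernel from its injectivity.\<close>

lemma (in module_category) quotient_surjection:
  assumes "is_quotient_in R C M L Q q"
  shows "is_surjection C M Q q" "a_kernel M Q q \<subseteq> L"
proof -
  obtain \<theta> where L: "submodule L R M" and q: "is_arrow C M Q q"
    and bij: "bij_betw \<theta> (a_rcosets\<^bsub>M\<^esub> L) (carrier Q)"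
    and q_eq: "\<And>x. x \<in> carrier M \<Longrightarrow> q x = \<theta> (L +>\<^bsub>M\<^esub> x)"
    using assms by (auto simp: is_quotient_in_def quotient_module_def)
  interpret M: module R M
    using q obj_module by (auto simp: is_arrow_def)
  have Q: "module R Q"
    using q obj_module by (auto simp: is_arrow_def)
  have cosets: "a_rcosets\<^bsub>M\<^esub> L = (\<lambda>x. L +>\<^bsub>M\<^esub> x) ` carrier M"
    by (auto simp: A_RCOSETS_def' a_r_coset_def')
  have "q ` carrier M = \<theta> ` (a_rcosets\<^bsub>M\<^esub> L)"
    unfolding cosets image_image using q_eq by (auto intro!: image_cong)
  then show "is_surjection C M Q q"
    using bij q by (simp add: is_surjection_def bij_betw_def)
  show "a_kernel M Q q \<subseteq> L"
  proof
    fix x assume "x \<in> a_kernel M Q q"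
    then have x: "x \<in> carrier M" and "q x = q \<zero>\<^bsub>M\<^esub>"
      using linear_map_zero[OF M.module_axioms Q arrow_linear[OF q]] by (auto simp: a_kernel_def')
    \<comment> \<open>Both sides are cosets on which \<theta> takes the same value
      \<open>q x\<close>, and \<theta> is injective on cosets.\<close>
    then have "L +>\<^bsub>M\<^esub> x = L +>\<^bsub>M\<^esub> \<zero>\<^bsub>M\<^esub>"
      using bij q_eq unfolding cosets bij_betw_def inj_on_def by auto
    then have "L +>\<^bsub>M\<^esub> x = L"
      using M.submoduleE(1)[OF L] by simp
    then show "x \<in> L"
      using M.a_coset_join1[OF _ x submodule.axioms(1)[OF L]] by simp
  qed
qed

text \<open>The first isomorphism theorem. It allows residuality to be applied to a presentation,
  which is then the natural map modulo its own kernel.\<close>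

lemma (in module_category) surjection_quotient:
  assumes "is_surjection C M N f"
  shows "is_quotient_in R C M (a_kernel M N f) N f"
proof -
  note f = surjection_linear[OF assms]
  interpret M: module R M by (rule f(1))
  interpret N: module R N by (rule f(2))
  define K where "K = a_kernel M N f"
  define \<theta> where "\<theta> X = the_elem (f ` X)" for X
  have K: "submodule K R M"
    unfolding K_def by (rule a_kernel_submodule[OF f(1-3)])
  interpret K: abelian_subgroup K M
    using submodule.axioms(1)[OF K] M.abelian_group_axioms
    by (intro abelian_subgroupI3 additive_subgroup.intro)
  have \<theta>: "\<theta> (K +>\<^bsub>M\<^esub> x) = f x" if "x \<in> carrier M" for x
    using a_coset_image[OF f(1-3) that] by (simp add: \<theta>_def K_def)
  have cosets: "carrier (quotient_module M K) = (\<lambda>x. K +>\<^bsub>M\<^esub> x) ` carrier M"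
    by (auto simp: quotient_module_def A_RCOSETS_def' a_r_coset_def')
  have smult: "a \<odot>\<^bsub>quotient_module M K\<^esub> (K +>\<^bsub>M\<^esub> x) = K +>\<^bsub>M\<^esub> (a \<odot>\<^bsub>M\<^esub> x)"
    if a: "a \<in> carrier R" and x: "x \<in> carrier M" for a x
  proof -
    \<comment> \<open>The scalar product in the quotient is a union over all representatives
      \<open>k + x\<close> of the coset. Since \<open>ak\<close> lies in \<open>K\<close>, every
      coset in that union is the coset of \<open>ax\<close>.\<close>
    have "K +>\<^bsub>M\<^esub> (a \<odot>\<^bsub>M\<^esub> (k \<oplus>\<^bsub>M\<^esub> x)) = K +>\<^bsub>M\<^esub> (a \<odot>\<^bsub>M\<^esub> x)" if k: "k \<in> K" for k
    proof -
      have "k \<in> carrier M" "a \<odot>\<^bsub>M\<^esub> k \<in> K"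
        using k a M.submoduleE(1,4)[OF K] by auto
      then have "a \<odot>\<^bsub>M\<^esub> (k \<oplus>\<^bsub>M\<^esub> x) \<in> K +>\<^bsub>M\<^esub> (a \<odot>\<^bsub>M\<^esub> x)"
        using a x by (auto simp: a_r_coset_def' M.smult_r_distr)
      then show ?thesis
        using K.a_repr_independence' a x by simp
    qed
    \<comment> \<open>A union of equal sets is that set only if the index set is nonempty.\<close>
    moreover have "K \<noteq> {}"
      using M.submoduleE(2)[OF K] .
    ultimately show ?thesis
      by (auto simp: quotient_module_def a_r_coset_def'[of M K x])
  qed
  have add: "(K +>\<^bsub>M\<^esub> x) \<oplus>\<^bsub>quotient_module M K\<^esub> (K +>\<^bsub>M\<^esub> y) = K +>\<^bsub>M\<^esub> (x \<oplus>\<^bsub>M\<^esub> y)"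
    if "x \<in> carrier M" "y \<in> carrier M" for x y
    using K.a_rcos_sum[OF that] by (simp add: quotient_module_def)
  have "\<theta> \<in> linear_maps R (quotient_module M K) N"
    using linear_map_closed[OF f(3)]
    by (auto simp: linear_maps_def hom_def cosets add smult \<theta>
        linear_map_add[OF f(3)] linear_map_smult[OF f(3)])
  moreover have "bij_betw \<theta> (carrier (quotient_module M K)) (carrier N)"
  proof (rule bij_betw_imageI)
    show "inj_on \<theta> (carrier (quotient_module M K))"
    proof (rule inj_onI)
      fix X Y
      assume "X \<in> carrier (quotient_module M K)" "Y \<in> carrier (quotient_module M K)"
        and eq: "\<theta> X = \<theta> Y"
      then obtain x y where x: "x \<in> carrier M" "X = K +>\<^bsub>M\<^esub> x" and y: "y \<in> carrier M" "Y = K +>\<^bsub>M\<^esub> y"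
        by (auto simp: cosets)
      \<comment> \<open>Injectivity of \<theta>: equal values of \<open>f\<close> differ by the
        kernel, so the representatives define one coset.\<close>
      have "x \<ominus>\<^bsub>M\<^esub> y \<in> K"
        using linear_map_eq_kernel[OF f(1-3) x(1) y(1)] eq x y unfolding K_def[symmetric]
        by (simp add: \<theta>)
      then have "x \<in> K +>\<^bsub>M\<^esub> y"
        using K.a_rcos_module x y by (simp add: M.minus_eq)
      then show "X = Y"
        using K.a_repr_independence' x y by simp
    qed
    show "\<theta> ` carrier (quotient_module M K) = carrier N"
      using f(4) by (simp add: cosets image_image \<theta>)
  qed
  ultimately show ?thesis
    using K assms \<theta> unfolding is_quotient_in_def is_surjection_def K_def by metis
qed

section \<open>Comparison and independence of presentations\<close>

locale cofunctorial_closure = cohereditary_setting R C \<P> \<P>'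
  for R :: "('r, 's) ring_scheme" and C :: "('r, 'm) module_cat" and \<P> \<P>' +
  fixes cl :: "('r, 'm) pair_op"
  assumes closure: "closure_operation R C \<P> cl"
    and cofun: "cofunctorial C \<P> cl"
begin

abbreviation cl\<^sub>r :: "('r, 'm) pair_op" where
  "cl\<^sub>r \<equiv> cohereditary_version C \<P> cl"

lemma cl_submodule: "(L, P) \<in> \<P> \<Longrightarrow> submodule (cl L P) R P"
  and cl_extensive: "(L, P) \<in> \<P> \<Longrightarrow> L \<subseteq> cl L P"
  and cl_mono: "(L, P) \<in> \<P> \<Longrightarrow> (N, P) \<in> \<P> \<Longrightarrow> L \<subseteq> N \<Longrightarrow> cl L P \<subseteq> cl N P"
  and cl_idem: "(L, P) \<in> \<P> \<Longrightarrow> (cl L P, P) \<in> \<P> \<Longrightarrow> cl (cl L P) P = cl L P"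
  using closure
  by (auto simp: closure_operation_def pair_operation_def extensive_def order_preserving_def
      idempotent_def)

lemma pair'_submodule: "(L, M) \<in> \<P>' \<Longrightarrow> submodule L R M"
  using pairs'_submodule by (auto simp: is_submodule_in_def)

lemma pair'_subset: "(L, M) \<in> \<P>' \<Longrightarrow> L \<subseteq> carrier M"
  using subgroup.subset[OF submodule.axioms(1)[OF pair'_submodule]] by auto

lemma cl_subset: "(L, P) \<in> \<P> \<Longrightarrow> cl L P \<subseteq> carrier P"
  using subgroup.subset[OF submodule.axioms(1)[OF cl_submodule]] by auto

lemma presentation_image_mono:
  assumes \<pi>: "is_presentation C \<P> (preimage M g L) M P \<pi>"
    and q: "is_presentation C \<P> L M' Q q"
    and g: "is_arrow C M M' g"
  shows "g ` \<pi> ` cl (preimage P \<pi> (preimage M g L)) P \<subseteq> q ` cl (preimage Q q L) Q"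
proof -
  let ?A = "preimage P \<pi> (preimage M g L)"
  have \<pi>': "is_projective C P" "is_arrow C P M \<pi>" "(?A, P) \<in> \<P>"
    using \<pi> by (auto simp: is_presentation_def is_surjection_def)
  have q': "is_surjection C Q M' q" "(preimage Q q L, Q) \<in> \<P>"
    using q by (auto simp: is_presentation_def)
  obtain \<psi> where \<psi>: "is_arrow C P Q \<psi>" "agree P (q \<circ> \<psi>) (g \<circ> \<pi>)"
    using projective_lift[OF \<pi>'(1) q'(1) arrow_comp[OF \<pi>'(2) g]] .
  have comm: "q (\<psi> x) = g (\<pi> x)" if "x \<in> carrier P" for x
    using that \<psi>(2) by (simp add: agree_def)
  \<comment> \<open>By commutativity of the square, pulling \<open>L\<close> back through
    \<open>q\<close> and \<psi> is the same as through \<open>g\<close> and \<pi>. So the pair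
    required by cofunctoriality along \<psi> is the one that \<pi> already places in \<P>.\<close>
  have A: "preimage P \<psi> (preimage Q q L) = ?A"
    using linear_map_closed[OF arrow_linear[OF \<psi>(1)]] linear_map_closed[OF arrow_linear[OF \<pi>'(2)]]
    by (auto simp: preimage_def comm)
  then have "cl ?A P \<subseteq> preimage P \<psi> (cl (preimage Q q L) Q)"
    using cofun \<psi>(1) q'(2) \<pi>'(3) unfolding cofunctorial_def by metis
  then have "\<psi> ` cl ?A P \<subseteq> cl (preimage Q q L) Q"
    by (auto simp: preimage_def)
  moreover have "g ` \<pi> ` cl ?A P = q ` \<psi> ` cl ?A P"
    unfolding image_image using comm cl_subset[OF \<pi>'(3)] by (intro image_cong) auto
  ultimately show ?thesis
    by (metis image_mono)
qed

lemma presentation_independent: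
  assumes L: "L \<subseteq> carrier M"
    and "is_presentation C \<P> L M P \<pi>" "is_presentation C \<P> L M Q q"
  shows "\<pi> ` cl (preimage P \<pi> L) P = q ` cl (preimage Q q L) Q"
proof -
  have "preimage M id L = L"
    using L by (auto simp: preimage_def)
  moreover have "is_arrow C M M id"
    using assms(2) arrow_id by (auto simp: is_presentation_def is_surjection_def is_arrow_def)
  \<comment> \<open>The comparison along the identity is used twice, with the two presentations
    exchanged.\<close>
  ultimately show ?thesis
    using presentation_image_mono[of M id L _ _ M] assms(2,3) by (metis image_id subset_antisym id_apply)
qed

lemma cohereditary_eq:
  assumes "(L, M) \<in> \<P>'" "is_presentation C \<P> L M P \<pi>"
  shows "cl\<^sub>r L M = \<pi> ` cl (preimage P \<pi> L) P"
proof -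
  obtain Q q where s: "(SOME (P, \<pi>). is_presentation C \<P> L M P \<pi>) = (Q, q)"
    by fastforce
  \<comment> \<open>The given presentation witnesses existence, so the choice operator does return a
    presentation.\<close>
  have "is_presentation C \<P> L M Q q"
    using someI[of "\<lambda>(P, \<pi>). is_presentation C \<P> L M P \<pi>" "(P, \<pi>)"] assms(2) s by simp
  then show ?thesis
    using presentation_independent[OF pair'_subset[OF assms(1)] assms(2)] s
    by (simp add: cohereditary_version_def)
qed

section \<open>The closure axioms for \<open>cl\<^sub>r\<close>\<close>

lemma presentation_surjection:
  assumes "is_presentation C \<P> L M P \<pi>"
  shows "is_surjection C P M \<pi>" "(preimage P \<pi> L, P) \<in> \<P>"
  using assms by (auto simp: is_presentation_def)

lemma cohereditary_submodule:
  assumes "(L, M) \<in> \<P>'"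
  shows "submodule (cl\<^sub>r L M) R M"
proof -
  obtain P \<pi> where \<pi>: "is_presentation C \<P> L M P \<pi>"
    using presentation_exists[OF assms] by blast
  note p = presentation_surjection[OF \<pi>]
  show ?thesis
    unfolding cohereditary_eq[OF assms \<pi>]
    using linear_image_submodule[OF surjection_linear(1-3)[OF p(1)] cl_submodule[OF p(2)]] .
qed

lemma cohereditary_extensive:
  assumes "(L, M) \<in> \<P>'"
  shows "L \<subseteq> cl\<^sub>r L M"
proof -
  obtain P \<pi> where \<pi>: "is_presentation C \<P> L M P \<pi>"
    using presentation_exists[OF assms] by blast
  note p = presentation_surjection[OF \<pi>]
  have "L = \<pi> ` preimage P \<pi> L"
    using image_preimage[OF surjection_linear(4)[OF p(1)] pair'_subset[OF assms]] by simp
  then show ?thesis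
    unfolding cohereditary_eq[OF assms \<pi>] using cl_extensive[OF p(2)] by blast
qed

text \<open>The condition \<open>preimage M q (q\<close> N) =
  N\<open>says that\<close>N\<open>is a union of fibres of\<close>q\<open>. Pulling\<close>q
  \<open>N\<close> back to \<open>P\<close> then gives the pullback of \<open>N\<close> itself, so
  the same pair in \<P> serves both modules. This form covers isomorphisms as well as quotient
  maps.\<close>

lemma presentation_comp:
  assumes "is_presentation C \<P> N M P \<pi>" "is_surjection C M Q q" "preimage M q (q ` N) = N"
  shows "is_presentation C \<P> (q ` N) Q P (q \<circ> \<pi>)" "preimage P (q \<circ> \<pi>) (q ` N) = preimage P \<pi> N"
proof -
  have \<pi>: "is_projective C P" "is_surjection C P M \<pi>" "(preimage P \<pi> N, P) \<in> \<P>"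
    using assms(1) by (auto simp: is_presentation_def)
  have "preimage P (q \<circ> \<pi>) (q ` N) = preimage P \<pi> (preimage M q (q ` N))"
    using linear_map_closed[OF surjection_linear(3)[OF \<pi>(2)]] by (auto simp: preimage_def)
  then show "preimage P (q \<circ> \<pi>) (q ` N) = preimage P \<pi> N"
    using assms(3) by simp
  then show "is_presentation C \<P> (q ` N) Q P (q \<circ> \<pi>)"
    using \<pi> surjection_comp[OF \<pi>(2) assms(2)] by (simp add: is_presentation_def)
qed

text \<open>Both sides are images of one and the same closure in \<open>P\<close>, under
  \<open>q \<circ> \<pi>\<close> and under \<pi> followed by \<open>q\<close>. Isomorphisms give
  invariance of the operation, quotient maps give residuality.\<close>

lemma cohereditary_surjection:
  assumes "(N, M) \<in> \<P>'" "(q ` N, Q) \<in> \<P>'" "is_surjection C M Q q" "preimage M q (q ` N) = N"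
  shows "cl\<^sub>r (q ` N) Q = q ` cl\<^sub>r N M"
proof -
  obtain P \<pi> where \<pi>: "is_presentation C \<P> N M P \<pi>"
    using presentation_exists[OF assms(1)] by blast
  show ?thesis
    using cohereditary_eq[OF assms(2) presentation_comp(1)[OF \<pi> assms(3,4)]]
      presentation_comp(2)[OF \<pi> assms(3,4)] cohereditary_eq[OF assms(1) \<pi>]
    by (simp add: image_comp)
qed

lemma cohereditary_pair_operation: "pair_operation R C \<P>' cl\<^sub>r"
proof -
  have "\<phi> ` cl\<^sub>r L M = cl\<^sub>r (\<phi> ` L) M'" if LM: "(L, M) \<in> \<P>'" and \<phi>: "is_isomorphism C M M' \<phi>" for L M M' \<phi>
  proof -
    have "(\<phi> ` L, M') \<in> \<P>'"
      using pairs'_iso_closed LM \<phi> by (auto simp: iso_closed_def)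
    moreover have "preimage M \<phi> (\<phi> ` L) = L"
      using pair'_subset[OF LM] isomorphism_bij(2)[OF \<phi>] by (auto simp: preimage_def inj_on_def)
    ultimately show ?thesis
      using cohereditary_surjection[OF LM _ isomorphism_bij(1)[OF \<phi>]] by simp
  qed
  then show ?thesis
    using cohereditary_submodule unfolding pair_operation_def by blast
qed

text \<open>A common presentation moves both submodules into one projective module, where
  monotonicity of \<open>cl\<close> applies.\<close>

lemma cohereditary_order_preserving: "order_preserving \<P>' cl\<^sub>r"
  unfolding order_preserving_def
proof (intro allI impI, elim conjE)
  fix L N M assume L: "(L, M) \<in> \<P>'" and N: "(N, M) \<in> \<P>'" and LN: "L \<subseteq> N"
  obtain P \<pi> where \<pi>: "is_presentation C \<P> L M P \<pi>" "is_presentation C \<P> N M P \<pi>"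
    using common_presentation[OF L N LN] by blast
  have "preimage P \<pi> L \<subseteq> preimage P \<pi> N"
    using LN by (auto simp: preimage_def)
  then show "cl\<^sub>r L M \<subseteq> cl\<^sub>r N M"
    unfolding cohereditary_eq[OF L \<pi>(1)] cohereditary_eq[OF N \<pi>(2)]
    using cl_mono presentation_surjection(2)[OF \<pi>(1)] presentation_surjection(2)[OF \<pi>(2)]
    by (meson image_mono)
qed

text \<open>With one presentation for \<open>L\<close> and for its closure, pulling the closure back
  to \<open>P\<close> gives \<open>cl ?A P\<close>; the second closure in \<open>M\<close> thus
  becomes a second application of \<open>cl\<close> in \<open>P\<close>.\<close>

lemma cohereditary_idempotent: "idempotent \<P>' cl\<^sub>r"
  unfolding idempotent_def
proof (intro allI impI, elim conjE)
  fix L M assume L: "(L, M) \<in> \<P>'" and N: "(cl\<^sub>r L M, M) \<in> \<P>'"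
  obtain P \<pi> where \<pi>: "is_presentation C \<P> L M P \<pi>" "is_presentation C \<P> (cl\<^sub>r L M) M P \<pi>"
    using common_presentation[OF L N cohereditary_extensive[OF L]] by blast
  let ?A = "preimage P \<pi> L"
  note p = presentation_surjection[OF \<pi>(1)]
  \<comment> \<open>Zero lies in \<open>L\<close>, so the kernel lies in \<open>?A\<close>, and
    extensivity carries it into the closure.\<close>
  have "a_kernel P M \<pi> \<subseteq> cl ?A P"
    by (rule order_trans[OF a_kernel_subset_preimage cl_extensive[OF p(2)]])
      (rule submodule_zero[OF pair'_submodule[OF L]])
  then have "preimage P \<pi> (cl\<^sub>r L M) = cl ?A P"
    unfolding cohereditary_eq[OF L \<pi>(1)]
    by (rule preimage_image[OF surjection_linear(1-3)[OF p(1)] cl_submodule[OF p(2)]])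
  \<comment> \<open>Idempotence of \<open>cl\<close> requires
    \<open>(cl ?A P, P) \<in> \<P>\<close>; this is what the presentation of
    \<open>cl\<^sub>r L M\<close> provides, once its preimage is identified.\<close>
  then show "cl\<^sub>r (cl\<^sub>r L M) M = cl\<^sub>r L M"
    using cohereditary_eq[OF L \<pi>(1)] cohereditary_eq[OF N \<pi>(2)] presentation_surjection(2)[OF \<pi>(2)]
      cl_idem[OF p(2)]
    by simp
qed

lemma cohereditary_closure_operation: "closure_operation R C \<P>' cl\<^sub>r"
  using cohereditary_pair_operation cohereditary_extensive cohereditary_order_preserving
    cohereditary_idempotent
  by (auto simp: closure_operation_def extensive_def)

section \<open>Cofunctoriality, residuality and comparison with \<open>cl\<close>\<close>

lemma cohereditary_cofunctorial: "cofunctorial C \<P>' cl\<^sub>r"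
  unfolding cofunctorial_def
proof (intro allI impI, elim conjE)
  fix L M M' g
  assume g: "is_arrow C M M' g" and L: "(L, M') \<in> \<P>'" and gL: "(preimage M g L, M) \<in> \<P>'"
  obtain P \<pi> where \<pi>: "is_presentation C \<P> (preimage M g L) M P \<pi>"
    using presentation_exists[OF gL] by blast
  obtain Q q where q: "is_presentation C \<P> L M' Q q"
    using presentation_exists[OF L] by blast
  have "g ` cl\<^sub>r (preimage M g L) M \<subseteq> cl\<^sub>r L M'"
    using presentation_image_mono[OF \<pi> q g] cohereditary_eq[OF L q] cohereditary_eq[OF gL \<pi>] by simp
  moreover have "cl\<^sub>r (preimage M g L) M \<subseteq> carrier M"
    using subgroup.subset[OF submodule.axioms(1)[OF cohereditary_submodule[OF gL]]] by simp
  ultimately show "cl\<^sub>r (preimage M g L) M \<subseteq> preimage M g (cl\<^sub>r L M')"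
    by (auto simp: preimage_def)
qed

lemma cohereditary_residual: "residual R C \<P>' cl\<^sub>r"
  unfolding residual_def
proof (intro allI impI, elim conjE)
  fix L N M Q q
  assume LN: "L \<subseteq> N" and N: "(N, M) \<in> \<P>'" and quot: "is_quotient_in R C M L Q q"
    and qN: "(q ` N, Q) \<in> \<P>'"
  note q = quotient_surjection[OF quot]
  have ker: "a_kernel M Q q \<subseteq> N"
    using q(2) LN by blast
  note pre = preimage_image[OF surjection_linear(1-3)[OF q(1)]]
  have "cl\<^sub>r (q ` N) Q = q ` cl\<^sub>r N M"
    using cohereditary_surjection[OF N qN q(1) pre[OF pair'_submodule[OF N] ker]] .
  \<comment> \<open>The closure of \<open>N\<close> contains \<open>N\<close> and hence the kernel
    of \<open>q\<close>, so it is recovered from its image in \<open>Q\<close>.\<close>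
  then show "cl\<^sub>r N M = preimage M q (cl\<^sub>r (q ` N) Q)"
    using pre[OF cohereditary_submodule[OF N]] ker cohereditary_extensive[OF N] by auto
qed

text \<open>Residuality along a presentation \<pi> expresses the closure in \<open>P\<close> as the
  preimage of \<open>cl L M\<close>; applying the surjection \<pi> gives back \<open>cl L M\<close>
  on one side and the formula for \<open>cl\<^sub>r\<close> on the other.\<close>

lemma residual_eq_cohereditary:
  assumes "pair_operation R C \<P>' cl" "residual R C \<P>' cl" "(L, M) \<in> \<P>'"
  shows "cl L M = cl\<^sub>r L M"
proof -
  obtain P \<pi> where \<pi>: "is_presentation C \<P> L M P \<pi>"
    using presentation_exists[OF assms(3)] by blast
  note p = presentation_surjection[OF \<pi>]
  note f = surjection_linear[OF p(1)]
  have L: "\<pi> ` preimage P \<pi> L = L"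
    using image_preimage[OF f(4) pair'_subset[OF assms(3)]] .
  have "a_kernel P M \<pi> \<subseteq> preimage P \<pi> L"
    using a_kernel_subset_preimage[OF submodule_zero[OF pair'_submodule[OF assms(3)]]] .
  \<comment> \<open>The submodule divided out is the kernel of \<pi>, with \<open>M\<close>
    representing the quotient. The pair in \<open>P\<close> belongs to \<open>\<P>'\<close> because
    \<P> is contained in it.\<close>
  then have "cl (preimage P \<pi> L) P = preimage P \<pi> (cl (\<pi> ` preimage P \<pi> L) M)"
    using assms(2)[unfolded residual_def, rule_format,
        of "a_kernel P M \<pi>" "preimage P \<pi> L" P M \<pi>]
      p(2) pairs_subset surjection_quotient[OF p(1)] assms(3) by (auto simp: L)
  then have eq: "cl (preimage P \<pi> L) P = preimage P \<pi> (cl L M)"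
    by (simp only: L)
  \<comment> \<open>That \<open>cl\<close> is a pair operation on all of \<open>\<P>'\<close> places
    \<open>cl L M\<close> inside \<open>M\<close>, so that \<pi> maps its preimage onto it.\<close>
  have "submodule (cl L M) R M"
    using assms(1,3) by (auto simp: pair_operation_def)
  then have "cl L M \<subseteq> carrier M"
    by (rule module.submoduleE(1)[OF f(2)])
  then show ?thesis
    unfolding cohereditary_eq[OF assms(3) \<pi>] eq by (rule image_preimage[OF f(4), symmetric])
qed

end

theorem proposition4p7:
  fixes R :: "('r, 's) ring_scheme"
    and C :: "('r, 'm) module_cat"
    and \<P> \<P>' :: "('r, 'm) pairs"
    and cl :: "('r, 'm) pair_op"
  assumes "cohereditary_setting R C \<P> \<P>'"
    and "closure_operation R C \<P> cl"
    and "cofunctorial C \<P> cl"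
  shows "closure_operation R C \<P>' (cohereditary_version C \<P> cl) \<and>
    cofunctorial C \<P>' (cohereditary_version C \<P> cl) \<and>
    residual R C \<P>' (cohereditary_version C \<P> cl) \<and>
    (\<forall>(L, M)\<in>\<P>'. \<forall>P \<pi>. is_projective C P \<and> is_surjection C P M \<pi> \<and> (preimage P \<pi> L, P) \<in> \<P> \<longrightarrow>
       cohereditary_version C \<P> cl L M = \<pi> ` cl (preimage P \<pi> L) P) \<and>
    (pair_operation R C \<P>' cl \<and> cofunctorial C \<P>' cl \<and> residual R C \<P>' cl \<longrightarrow>
       (\<forall>(L, M)\<in>\<P>'. cl L M = cohereditary_version C \<P> cl L M))"
proof -
  interpret cofunctorial_closure R C \<P> \<P>' cl
    using assms by (simp add: cofunctorial_closure_def cofunctorial_closure_axioms_def)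
  show ?thesis
    using cohereditary_closure_operation cohereditary_cofunctorial cohereditary_residual
      cohereditary_eq residual_eq_cohereditary
    by (auto simp: is_presentation_def)
qed

end
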